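(* Let $\mathbf{C}$ be the natural deduction system described in the context. For any deduction in $\mathbf{C}$, there is a deduction in $\mathbf{C}$ in normal form of the same conclusion from the same undischarged assumptions.
   Context: Formulas are built from atomic formulas (formulas containing no connective) by the connectives $\neg$ (unary), $\supset$, $\land$, $\lor$. Deductions in $\mathbf{C}$ are trees of formula occurrences whose leaves are assumptions; each assumption belongs to an assumption class marked by a number, and a rule discharging class $i$ (written $[X]^i$) discharges all assumptions of that class above the indicated premise. A single assumption $A$ is a deduction of $A$ from $A$. Rules ($C$ arbitrary): $\land I$: from $A$, $B$, and a deduction of $C$ from $[A\land B]$, infer $C$. $\land E$: from $A\land B$ and a deduction of $C$ from $[A]$, $[B]$, infer $C$. $\lor I$: from $A$ (or from $B$) and a deduction of $C$ from $[A\lor B]$, infer $C$. $\lor E$: from $A\lor B$, a deduction of $C$ from $[A]$, and a deduction of $C$ from $[B]$, infer $C$. $\supset I$: from $B$ and a deduction of $C$ from $[A\supset B]$, infer $C$. $TR$ (an introduction rule for $\supset$): from a deduction of $C$ from $[A]$ and a deduction of $C$ from $[A\supset B]$, infer $C$. $\supset E$: from $A\supset B$, $A$, and a deduction of $C$ from $[B]$, infer $C$. $\neg I$: from a deduction of $C$ from $[A]$ and a deduction of $C$ from $[\neg A]$, infer $C$. $\neg E$: from $\neg A$ and $A$, infer $C$. Introduction rules: $\land I,\lor I,\supset I,TR,\neg I$; elimination rules: $\land E,\lor E,\supset E,\neg E$. In elimination rules $A\land B, A\lor B, A\supset B,\neg A$ are the major premises; premises in the place of $C$ (in any rule) are arbitrary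 premises; the discharged $A\land B$, $A\lor B$, $A\supset B$ (in $\supset I$ and $TR$), $\neg A$ (in $\neg I$) are the major assumptions discharged by the introduction rule. Convention: there is no vacuous discharge above arbitrary premises (every discharge in a rule application above an arbitrary premise discharges at least one assumption occurrence, except that $\land E$ may discharge only one of $A$, $B$). A maximal formula is an occurrence of a formula with main connective $\ast$ that is both the major premise of an application of $\ast E$ and the major assumption discharged by an application of $\ast I$ (or of $TR$ when $\ast$ is $\supset$). A segment is a sequence $C_1,\dots,C_n$ of occurrences of the same formula such that for all $i<n$, $C_i$ is an arbitrary premise of a rule application whose conclusion is $C_{i+1}$, $C_n$ is not an arbitrary premise of any rule application, and either $n>1$, or $n\ge 1$ and $C_1$ is the conclusion of an application of $\neg E$. A maximal segment is a segment whose last formula is the major premise of an elimination rule. A deduction is in normal form if it contains neither maximal formulas nor maximal segments.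
   Formalization: "From the same undischarged assumptions" is proved as: the undischarged assumptions of the normal deduction are among those of the given one; equality fails, e.g. for p deduced from p, q by ∧I and then ∧E discharging only p. *)

theory Defs
  imports Main
begin

datatype 'a form =
    Atom 'a
  | Neg "'a form"
  | Imp "'a form" "'a form"
  | And "'a form" "'a form"
  | Or "'a form" "'a form"

text \<open>An assumption class is identified by its number together with the formula assumed.\<close>

type_synonym 'a assm_class = "nat \<times> 'a form"

text \<open>Rule instances.  The formula arguments are the schematic \<open>A\<close> and \<open>B\<close>; the numbers are
  those of the discharged classes, in the order in which \<open>rule_premises\<close> below uses them.\<close>

datatype 'a rule =
    AndI "'a form" "'a form" nat
  | AndE "'a form" "'a form" nat nat
  | OrI1 "'a form" "'a form" nat
  | OrI2 "'a form" "'a form" nat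
  | OrE "'a form" "'a form" nat nat
  | ImpI "'a form" "'a form" nat
  | TR "'a form" "'a form" nat nat
  | ImpE "'a form" "'a form" nat
  | NegI "'a form" nat nat
  | NegE "'a form"

text \<open>\<open>Major\<close> is used for elimination rules only; \<open>Arbitrary\<close> carries the classes discharged above
  the premise.\<close>

datatype 'a premise =
    Major "'a form"
  | Minor "'a form"
  | Arbitrary "'a assm_class set"

fun rule_premises :: "'a rule \<Rightarrow> 'a premise list" where
  "rule_premises (AndI A B i) = [Minor A, Minor B, Arbitrary {(i, And A B)}]"
| "rule_premises (AndE A B i j) = [Major (And A B), Arbitrary {(i, A), (j, B)}]"
| "rule_premises (OrI1 A B i) = [Minor A, Arbitrary {(i, Or A B)}]"
| "rule_premises (OrI2 A B i) = [Minor B, Arbitrary {(i, Or A B)}]"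
| "rule_premises (OrE A B i j) = [Major (Or A B), Arbitrary {(i, A)}, Arbitrary {(j, B)}]"
| "rule_premises (ImpI A B i) = [Minor B, Arbitrary {(i, Imp A B)}]"
| "rule_premises (TR A B i j) = [Arbitrary {(i, A)}, Arbitrary {(j, Imp A B)}]"
| "rule_premises (ImpE A B i) = [Major (Imp A B), Minor A, Arbitrary {(i, B)}]"
| "rule_premises (NegI A i j) = [Arbitrary {(i, A)}, Arbitrary {(j, Neg A)}]"
| "rule_premises (NegE A) = [Major (Neg A), Minor A]"

fun discharged :: "'a premise \<Rightarrow> 'a assm_class set" where
  "discharged (Arbitrary D) = D"
| "discharged _ = {}"

text \<open>\<open>None\<close> exactly for the elimination rules.\<close>

fun major_assumption :: "'a rule \<Rightarrow> 'a form option" where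
  "major_assumption (AndI A B i) = Some (And A B)"
| "major_assumption (OrI1 A B i) = Some (Or A B)"
| "major_assumption (OrI2 A B i) = Some (Or A B)"
| "major_assumption (ImpI A B i) = Some (Imp A B)"
| "major_assumption (TR A B i j) = Some (Imp A B)"
| "major_assumption (NegI A i j) = Some (Neg A)"
| "major_assumption _ = None"

text \<open>\<open>Infer r C ds\<close> concludes \<open>C\<close> by \<open>r\<close> from the conclusions of \<open>ds\<close>, listed in the order of
  \<open>rule_premises r\<close>.\<close>

datatype 'a tree =
    Assm nat "'a form"
  | Infer "'a rule" "'a form" "'a tree list"

fun concl :: "'a tree \<Rightarrow> 'a form" where
  "concl (Assm i A) = A"
| "concl (Infer r C ds) = C"

text \<open>Normalisation can erase assumptions, even though vacuous discharge is banned: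
  for distinct atoms \<open>p\<close>, \<open>q\<close> there is a deduction of \<open>p\<close> using exactly the assumptions \<open>p\<close>, \<open>q\<close>
  (\<open>\<and>I\<close> followed by \<open>\<and>E\<close>), but by the subformula property the only normal deduction of \<open>p\<close> from
  them is the single assumption \<open>p\<close>.  Hence, as is usual, a deduction from a collection of
  assumptions is one whose undischarged assumptions are all among them.\<close>

primrec undischarged :: "'a tree \<Rightarrow> 'a assm_class set" where
  "undischarged (Assm i A) = {(i, A)}"
| "undischarged (Infer r C ds) =
     \<Union> (set (map2 (\<lambda>P U. U - discharged P) (rule_premises r) (map undischarged ds)))"

text \<open>Vacuous discharge is excluded by the last equation: only \<open>\<and>E\<close> has more than one class to
  discharge above the same premise, and there one of the two suffices.\<close>

fun fits :: "'a form \<Rightarrow> 'a premise \<Rightarrow> 'a tree \<Rightarrow> bool" where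
  "fits C (Major A) d \<longleftrightarrow> concl d = A"
| "fits C (Minor A) d \<longleftrightarrow> concl d = A"
| "fits C (Arbitrary D) d \<longleftrightarrow> concl d = C \<and> D \<inter> undischarged d \<noteq> {}"

inductive deduction :: "'a tree \<Rightarrow> bool" where
  "deduction (Assm i A)"
| "(\<And>d. d \<in> set ds \<Longrightarrow> deduction d) \<Longrightarrow> list_all2 (fits C) (rule_premises r) ds
     \<Longrightarrow> deduction (Infer r C ds)"

text \<open>An occurrence in a tree is the path leading to it from the root; the formula occurring there
  is the conclusion of the subtree.\<close>

fun subtree :: "'a tree \<Rightarrow> nat list \<Rightarrow> 'a tree option" where
  "subtree d [] = Some d"
| "subtree (Assm i A) (k # p) = None"
| "subtree (Infer r C ds) (k # p) = (if k < length ds then subtree (ds ! k) p else None)"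

text \<open>The occurrence \<open>q\<close> is a premise, of the kind \<open>P\<close>, of the application with conclusion \<open>p\<close>.\<close>

definition premise_of :: "'a tree \<Rightarrow> nat list \<Rightarrow> 'a premise \<Rightarrow> nat list \<Rightarrow> bool" where
  "premise_of d q P p \<longleftrightarrow>
     (\<exists>r C ds k. subtree d p = Some (Infer r C ds) \<and> k < length ds \<and>
        q = p @ [k] \<and> P = rule_premises r ! k)"

definition major_premise :: "'a tree \<Rightarrow> nat list \<Rightarrow> bool" where
  "major_premise d q \<longleftrightarrow> (\<exists>A p. premise_of d q (Major A) p)"

definition arbitrary_premise_of :: "'a tree \<Rightarrow> nat list \<Rightarrow> nat list \<Rightarrow> bool" where
  "arbitrary_premise_of d q p \<longleftrightarrow> (\<exists>D. premise_of d q (Arbitrary D) p)"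

text \<open>The application at \<open>p\<close> has a premise above which it discharges the class of the assumption
  at \<open>q\<close>; of several such applications the uppermost one discharges it.\<close>

definition may_discharge :: "'a tree \<Rightarrow> nat list \<Rightarrow> nat list \<Rightarrow> bool" where
  "may_discharge d p q \<longleftrightarrow>
     (\<exists>i A P p' s. subtree d q = Some (Assm i A) \<and> premise_of d p' P p \<and>
        q = p' @ s \<and> (i, A) \<in> discharged P)"

definition discharges :: "'a tree \<Rightarrow> nat list \<Rightarrow> nat list \<Rightarrow> bool" where
  "discharges d p q \<longleftrightarrow>
     may_discharge d p q \<and> (\<forall>p'. may_discharge d p' q \<longrightarrow> length p' \<le> length p)"

text \<open>Comparing formulas suffices in the next definition, since in \<open>TR\<close> and \<open>\<not>I\<close> the other
  discharged formula differs from the major assumption.  The elimination and the introduction rule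
  belong to the same connective because they share the formula.\<close>

definition major_assumption_occ :: "'a tree \<Rightarrow> nat list \<Rightarrow> bool" where
  "major_assumption_occ d q \<longleftrightarrow>
     (\<exists>p r C ds i A. subtree d p = Some (Infer r C ds) \<and> subtree d q = Some (Assm i A) \<and>
        discharges d p q \<and> major_assumption r = Some A)"

definition maximal_formula :: "'a tree \<Rightarrow> nat list \<Rightarrow> bool" where
  "maximal_formula d q \<longleftrightarrow> major_premise d q \<and> major_assumption_occ d q"

definition segment :: "'a tree \<Rightarrow> nat list list \<Rightarrow> bool" where
  "segment d qs \<longleftrightarrow>
     qs \<noteq> [] \<and>
     (\<exists>C. \<forall>q \<in> set qs. map_option concl (subtree d q) = Some C) \<and>
     (\<forall>i. Suc i < length qs \<longrightarrow> arbitrary_premise_of d (qs ! i) (qs ! Suc i)) \<and>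
     (\<nexists>p. arbitrary_premise_of d (last qs) p) \<and>
     (length qs > 1 \<or> (\<exists>A C ds. subtree d (hd qs) = Some (Infer (NegE A) C ds)))"

definition maximal_segment :: "'a tree \<Rightarrow> nat list list \<Rightarrow> bool" where
  "maximal_segment d qs \<longleftrightarrow> segment d qs \<and> major_premise d (last qs)"

definition normal :: "'a tree \<Rightarrow> bool" where
  "normal d \<longleftrightarrow> (\<nexists>q. maximal_formula d q) \<and> (\<nexists>qs. maximal_segment d qs)"

end

theory Submission
  imports Defs
begin

text \<open>The system is sound for classical two-valued semantics, so it suffices that normal deductions
  are complete.  A deduction whose major premises are all assumptions is normal as soon as none of
  them is discharged as the major assumption of an introduction rule.  Consider such deductions of
  \<open>C\<close> with undischarged assumptions in a set \<open>U\<close>, of which only those in \<open>E \<subseteq> U\<close> may be major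
  premises.  If there are none, first \<open>E\<close> and then \<open>U\<close> can be enlarged to maximal sets for which
  there are none.  Every rule then becomes a closure condition on \<open>E\<close> and \<open>U\<close>, in which major
  premises and discharged subformulas refer to \<open>E\<close>, minor premises and discharged major assumptions
  to \<open>U\<close>.  Reading membership in \<open>E\<close> as truth and non-membership in \<open>U\<close> as falsity, these are the
  conditions on a Hintikka set; hence the valuation given by the atoms in \<open>E\<close> satisfies \<open>E\<close> and
  refutes \<open>C\<close>.\<close>

section \<open>Soundness\<close>

primrec holds :: "('a \<Rightarrow> bool) \<Rightarrow> 'a form \<Rightarrow> bool" where
  "holds v (Atom a) \<longleftrightarrow> v a"
| "holds v (Neg A) \<longleftrightarrow> \<not> holds v A"
| "holds v (Imp A B) \<longleftrightarrow> (holds v A \<longrightarrow> holds v B)"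
| "holds v (And A B) \<longleftrightarrow> holds v A \<and> holds v B"
| "holds v (Or A B) \<longleftrightarrow> holds v A \<or> holds v B"

fun premise_holds :: "('a \<Rightarrow> bool) \<Rightarrow> 'a form \<Rightarrow> 'a premise \<Rightarrow> bool" where
  "premise_holds v C (Major A) \<longleftrightarrow> holds v A"
| "premise_holds v C (Minor A) \<longleftrightarrow> holds v A"
| "premise_holds v C (Arbitrary D) \<longleftrightarrow> ((\<forall>x \<in> D. holds v (snd x)) \<longrightarrow> holds v C)"

lemma rule_sound: "\<forall>Q \<in> set (rule_premises r). premise_holds v C Q \<Longrightarrow> holds v C"
  by (cases r) auto

lemma premise_holds_if_fits:
  assumes "fits C Q d"
    and "\<forall>x \<in> undischarged d. holds v (snd x) \<Longrightarrow> holds v (concl d)"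
    and "\<forall>x \<in> undischarged d - discharged Q. holds v (snd x)"
  shows "premise_holds v C Q"
  using assms by (cases Q) auto

lemma undischarged_Infer:
  assumes "length ds = length (rule_premises r)"
  shows "undischarged (Infer r C ds) =
    (\<Union>k < length ds. undischarged (ds ! k) - discharged (rule_premises r ! k))"
  using assms by (fastforce simp: set_zip)

lemma deduction_sound:
  assumes "deduction d" and "\<forall>x \<in> undischarged d. holds v (snd x)"
  shows "holds v (concl d)"
  using assms
proof (induction rule: deduction.induct[case_names Assm Infer])
  case (Assm i A)
  then show ?case by simp
next
  case (Infer ds C r)
  have length: "length ds = length (rule_premises r)"
    and fits: "\<And>k. k < length ds \<Longrightarrow> fits C (rule_premises r ! k) (ds ! k)"
    using Infer.hyps by (auto simp: list_all2_conv_all_nth)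
  have "premise_holds v C (rule_premises r ! k)" if k: "k < length ds" for k
  proof (rule premise_holds_if_fits[OF fits[OF k]])
    show "holds v (concl (ds ! k))" if "\<forall>x \<in> undischarged (ds ! k). holds v (snd x)"
      using Infer.IH k that nth_mem by blast
    show "\<forall>x \<in> undischarged (ds ! k) - discharged (rule_premises r ! k). holds v (snd x)"
      using Infer.prems k unfolding undischarged_Infer[OF length] by blast
  qed
  then have "\<forall>Q \<in> set (rule_premises r). premise_holds v C Q"
    using length by (metis in_set_conv_nth)
  then show ?case by (simp add: rule_sound)
qed

section \<open>A compositional criterion for normality\<close>

text \<open>A class discharged as the major assumption is removed even if it belongs to \<open>E\<close>: the discharge
  hides the class of the same number and formula that is open below.\<close>

definition eliminable_above ::
    "'a rule \<Rightarrow> 'a premise \<Rightarrow> 'a assm_class set \<Rightarrow> 'a assm_class set" where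
  "eliminable_above r Q E =
     E \<union> discharged Q - {x \<in> discharged Q. major_assumption r = Some (snd x)}"

inductive majors_in :: "'a assm_class set \<Rightarrow> 'a tree \<Rightarrow> bool" where
  Assm: "majors_in E (Assm i A)"
| Infer: "(\<And>k A. k < length ds \<Longrightarrow> rule_premises r ! k = Major A \<Longrightarrow>
              \<exists>i B. ds ! k = Assm i B \<and> (i, B) \<in> E) \<Longrightarrow>
          (\<And>k. k < length ds \<Longrightarrow> majors_in (eliminable_above r (rule_premises r ! k) E) (ds ! k)) \<Longrightarrow>
          majors_in E (Infer r C ds)"

inductive_cases majors_in_InferE: "majors_in E (Infer r C ds)"

lemma may_discharge_iff:
  "may_discharge d p q \<longleftrightarrow>
     (\<exists>i A r C ds k s. subtree d q = Some (Assm i A) \<and> subtree d p = Some (Infer r C ds) \<and>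
        k < length ds \<and> q = p @ k # s \<and> (i, A) \<in> discharged (rule_premises r ! k))"
  unfolding may_discharge_def premise_of_def by fastforce

lemma not_may_discharge_root: "\<not> may_discharge d p []"
  by (simp add: may_discharge_iff)

lemma may_discharge_Infer_Cons:
  assumes "k < length ds" and "subtree (ds ! k) q = Some (Assm i A)"
  shows "may_discharge (Infer r C ds) p (k # q) \<longleftrightarrow>
    p = [] \<and> (i, A) \<in> discharged (rule_premises r ! k) \<or>
    (\<exists>p'. p = k # p' \<and> may_discharge (ds ! k) p' q)"
  using assms by (cases p) (auto simp: may_discharge_iff)

lemma major_assumption_occ_Infer_Cons:
  assumes "k < length ds" and "subtree (ds ! k) q = Some (Assm i A)"
    and "major_assumption_occ (Infer r C ds) (k # q)"
  shows "major_assumption_occ (ds ! k) q \<or>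
    (\<forall>p. \<not> may_discharge (ds ! k) p q) \<and>
    (i, A) \<in> discharged (rule_premises r ! k) \<and> major_assumption r = Some A"
proof -
  note may_discharge_Infer = may_discharge_Infer_Cons[OF assms(1,2), of r C]
  obtain p r' C' ds' where sub: "subtree (Infer r C ds) p = Some (Infer r' C' ds')"
    and discharging: "may_discharge (Infer r C ds) p (k # q)"
    and uppermost: "\<And>p'. may_discharge (Infer r C ds) p' (k # q) \<Longrightarrow> length p' \<le> length p"
    and major: "major_assumption r' = Some A"
    using assms unfolding major_assumption_occ_def discharges_def by auto
  from discharging consider
    (root) "p = []" "(i, A) \<in> discharged (rule_premises r ! k)" |
    (above) p' where "p = k # p'" "may_discharge (ds ! k) p' q"
    unfolding may_discharge_Infer by blast
  then show ?thesis
  proof cases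
    case root
    have "\<not> may_discharge (ds ! k) p' q" for p'
      using uppermost[of "k # p'"] root(1) by (auto simp: may_discharge_Infer)
    then show ?thesis using root sub major by simp
  next
    case above
    have "discharges (ds ! k) p' q"
      unfolding discharges_def using above uppermost by (fastforce simp: may_discharge_Infer)
    then have "major_assumption_occ (ds ! k) q"
      unfolding major_assumption_occ_def using above(1) sub major assms(1,2) by auto
    then show ?thesis ..
  qed
qed

definition eliminable_occ :: "'a assm_class set \<Rightarrow> 'a tree \<Rightarrow> nat list \<Rightarrow> bool" where
  "eliminable_occ E d q \<longleftrightarrow>
     (\<exists>i A. subtree d q = Some (Assm i A) \<and> ((\<forall>p. \<not> may_discharge d p q) \<longrightarrow> (i, A) \<in> E)) \<and>
     \<not> major_assumption_occ d q"

lemma eliminable_occ_Assm: "(i, A) \<in> E \<Longrightarrow> eliminable_occ E (Assm i A) []"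
  by (simp add: eliminable_occ_def major_assumption_occ_def discharges_def not_may_discharge_root)

lemma eliminable_occ_Infer_Cons:
  assumes "k < length ds"
    and "eliminable_occ (eliminable_above r (rule_premises r ! k) E) (ds ! k) q"
  shows "eliminable_occ E (Infer r C ds) (k # q)"
proof -
  obtain i A where sub: "subtree (ds ! k) q = Some (Assm i A)"
    and undischarged: "(\<forall>p. \<not> may_discharge (ds ! k) p q) \<longrightarrow>
      (i, A) \<in> eliminable_above r (rule_premises r ! k) E"
    and not_major: "\<not> major_assumption_occ (ds ! k) q"
    using assms(2) unfolding eliminable_occ_def by blast
  have "(i, A) \<in> E" if "\<forall>p. \<not> may_discharge (Infer r C ds) p (k # q)"
    using that undischarged
    by (auto simp: may_discharge_Infer_Cons[OF assms(1) sub] eliminable_above_def)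
  moreover have "\<not> major_assumption_occ (Infer r C ds) (k # q)"
    using major_assumption_occ_Infer_Cons[OF assms(1) sub] not_major undischarged
    by (auto simp: eliminable_above_def)
  ultimately show ?thesis
    using sub assms(1) by (auto simp: eliminable_occ_def)
qed

lemma major_premise_Infer_Cons:
  "major_premise (Infer r C ds) (k # q) \<longleftrightarrow>
     k < length ds \<and>
     (if q = [] then \<exists>A. rule_premises r ! k = Major A else major_premise (ds ! k) q)"
proof (cases q rule: rev_cases)
  case Nil
  then show ?thesis
    by (auto simp: major_premise_def premise_of_def Cons_eq_append_conv eq_commute[of "Major _"])
next
  case (snoc q' l)
  then show ?thesis
    by (auto simp: major_premise_def premise_of_def Cons_eq_append_conv split: if_splits)
qed

lemma not_major_premise_root: "\<not> major_premise d []"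
  by (simp add: major_premise_def premise_of_def)

lemma not_major_premise_Assm: "\<not> major_premise (Assm i A) q"
proof
  assume "major_premise (Assm i A) q"
  then obtain p r C ds where "subtree (Assm i A) p = Some (Infer r C ds)"
    unfolding major_premise_def premise_of_def by blast
  then show False by (cases p) auto
qed

lemma majors_in_imp_eliminable_occ:
  assumes "majors_in E d" and "major_premise d q"
  shows "eliminable_occ E d q"
  using assms
proof (induction arbitrary: q rule: majors_in.induct)
  case (Assm E i A)
  then show ?case by (simp add: not_major_premise_Assm)
next
  case (Infer ds r E C)
  obtain k q' where q: "q = k # q'"
    using Infer.prems not_major_premise_root by (metis neq_Nil_conv)
  with Infer.prems have k: "k < length ds" by (simp add: major_premise_Infer_Cons)
  have "eliminable_occ (eliminable_above r (rule_premises r ! k) E) (ds ! k) q'"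
  proof (cases "q' = []")
    case True
    with Infer.prems q obtain A where A: "rule_premises r ! k = Major A"
      by (auto simp: major_premise_Infer_Cons)
    with Infer.hyps(1) k obtain i B where "ds ! k = Assm i B" "(i, B) \<in> E" by blast
    with A True show ?thesis by (simp add: eliminable_above_def eliminable_occ_Assm)
  next
    case False
    with Infer.prems q have "major_premise (ds ! k) q'" by (simp add: major_premise_Infer_Cons)
    with Infer.IH k show ?thesis by blast
  qed
  with k q show ?case by (simp add: eliminable_occ_Infer_Cons)
qed

lemma segment_end_not_Assm:
  assumes "segment d qs"
  shows "subtree d (last qs) \<noteq> Some (Assm i A)"
proof (cases qs rule: rev_cases)
  case Nil
  with assms show ?thesis by (simp add: segment_def)
next
  case (snoc qs' q)
  show ?thesis
  proof (cases qs' rule: rev_cases)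
    case Nil
    with assms snoc show ?thesis by (auto simp: segment_def)
  next
    case (snoc qs'' q')
    with assms \<open>qs = qs' @ [q]\<close> have "arbitrary_premise_of d q' q"
      unfolding segment_def by (auto simp: nth_append dest!: spec[of _ "length qs''"])
    with \<open>qs = qs' @ [q]\<close> show ?thesis by (auto simp: arbitrary_premise_of_def premise_of_def)
  qed
qed

lemma majors_in_imp_normal:
  assumes "majors_in E d"
  shows "normal d"
proof -
  have leaf: "\<exists>i A. subtree d q = Some (Assm i A)" "\<not> major_assumption_occ d q"
    if "major_premise d q" for q
    using majors_in_imp_eliminable_occ[OF assms that] by (auto simp: eliminable_occ_def)
  then show ?thesis
    by (auto simp: normal_def maximal_formula_def maximal_segment_def dest: segment_end_not_Assm)
qed

section \<open>Normal derivability\<close>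

definition normally_derivable ::
    "'a assm_class set \<Rightarrow> 'a assm_class set \<Rightarrow> 'a form \<Rightarrow> bool" where
  "normally_derivable E U C \<longleftrightarrow>
     (\<exists>d. deduction d \<and> majors_in E d \<and> concl d = C \<and> undischarged d \<subseteq> U)"

lemma majors_in_undischarged_mono:
  assumes "deduction d" and "majors_in F d" and "F \<inter> undischarged d \<subseteq> E"
  shows "majors_in E d"
  using assms
proof (induction d arbitrary: E F rule: deduction.induct[case_names Assm Infer])
  case (Assm i A)
  then show ?case by (simp add: majors_in.Assm)
next
  case (Infer ds C r)
  have length: "length ds = length (rule_premises r)"
    using Infer.hyps by (simp add: list_all2_lengthD)
  have undischarged_above:
    "undischarged (ds ! k) - discharged (rule_premises r ! k) \<subseteq> undischarged (Infer r C ds)"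
    if "k < length ds" for k
    using that unfolding undischarged_Infer[OF length] by blast
  show ?case
  proof (rule majors_in.Infer)
    fix k A
    assume k: "k < length ds" and major: "rule_premises r ! k = Major A"
    then obtain i B where "ds ! k = Assm i B" "(i, B) \<in> F"
      using Infer.prems(1) by (meson majors_in_InferE)
    then show "\<exists>i B. ds ! k = Assm i B \<and> (i, B) \<in> E"
      using undischarged_above[OF k] major Infer.prems(2) by auto
  next
    fix k
    assume k: "k < length ds"
    let ?Q = "rule_premises r ! k"
    have "majors_in (eliminable_above r ?Q F) (ds ! k)"
      using Infer.prems(1) k by (meson majors_in_InferE)
    moreover have "eliminable_above r ?Q F \<inter> undischarged (ds ! k) \<subseteq> eliminable_above r ?Q E"
      using undischarged_above[OF k] Infer.prems(2) by (auto simp: eliminable_above_def)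
    ultimately show "majors_in (eliminable_above r ?Q E) (ds ! k)"
      using Infer.IH k by simp
  qed
qed

lemma normally_derivable_Assm: "(i, C) \<in> U \<Longrightarrow> normally_derivable E U C"
  unfolding normally_derivable_def
  by (intro exI[of _ "Assm i C"]) (auto intro: deduction.intros majors_in.intros)

lemma normally_derivable_mono:
  assumes "normally_derivable E U C" and "E \<subseteq> F" and "U \<subseteq> W"
  shows "normally_derivable F W C"
  using assms unfolding normally_derivable_def
  by (metis inf.coboundedI1 majors_in_undischarged_mono order_trans)

lemma finite_undischarged: "finite (undischarged d)"
proof (induction d)
  case (Infer r C ds)
  then show ?case by (auto dest!: set_zip_rightD)
qed simp

lemma normally_derivable_finite:
  assumes "normally_derivable E U C"
  obtains V where "finite V" "V \<subseteq> U" "normally_derivable (E \<inter> V) V C"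
proof -
  obtain d where d: "deduction d" "majors_in E d" "concl d = C" "undischarged d \<subseteq> U"
    using assms unfolding normally_derivable_def by blast
  then have "majors_in (E \<inter> undischarged d) d"
    by (blast intro: majors_in_undischarged_mono)
  with d have "normally_derivable (E \<inter> undischarged d) (undischarged d) C"
    unfolding normally_derivable_def by blast
  with d(4) show thesis by (intro that[OF finite_undischarged])
qed

definition premise_deduction ::
    "'a rule \<Rightarrow> 'a assm_class set \<Rightarrow> 'a assm_class set \<Rightarrow> 'a form \<Rightarrow> 'a premise \<Rightarrow> 'a tree \<Rightarrow> bool" where
  "premise_deduction r E U C Q d \<longleftrightarrow>
     deduction d \<and> fits C Q d \<and> majors_in (eliminable_above r Q E) d \<and>
     undischarged d - discharged Q \<subseteq> U \<and> (\<forall>A. Q = Major A \<longrightarrow> (\<exists>i. d = Assm i A \<and> (i, A) \<in> E))"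

lemma premise_deductions_imp_normally_derivable:
  assumes "\<And>Q. Q \<in> set (rule_premises r) \<Longrightarrow> premise_deduction r E U C Q (f Q)"
  shows "normally_derivable E U C"
proof -
  let ?Qs = "rule_premises r"
  let ?d = "Infer r C (map f ?Qs)"
  have "deduction ?d"
    using assms
    by (auto intro!: deduction.intros simp: premise_deduction_def list_all2_map2 list_all2_same)
  moreover have "majors_in E ?d"
  proof (rule majors_in.Infer)
    show "\<exists>i B. map f ?Qs ! k = Assm i B \<and> (i, B) \<in> E"
      if "k < length (map f ?Qs)" "?Qs ! k = Major A" for k A
      using that assms unfolding premise_deduction_def by (metis length_map nth_map nth_mem)
    show "majors_in (eliminable_above r (?Qs ! k) E) (map f ?Qs ! k)"
      if "k < length (map f ?Qs)" for k
      using that assms by (simp add: premise_deduction_def)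
  qed
  moreover have "undischarged ?d \<subseteq> U"
    using assms
    by (simp add: premise_deduction_def undischarged_Infer UN_subset_iff del: undischarged.simps)
  moreover have "concl ?d = C"
    by simp
  ultimately show ?thesis
    unfolding normally_derivable_def by (intro exI[of _ ?d] conjI)
qed

fun premise_derivable ::
    "'a rule \<Rightarrow> 'a assm_class set \<Rightarrow> 'a assm_class set \<Rightarrow> 'a form \<Rightarrow> 'a premise \<Rightarrow> bool" where
  "premise_derivable r E U C (Major A) \<longleftrightarrow> A \<in> snd ` (E \<inter> U)"
| "premise_derivable r E U C (Minor A) \<longleftrightarrow> A \<in> snd ` U"
| "premise_derivable r E U C (Arbitrary D) \<longleftrightarrow>
     normally_derivable (eliminable_above r (Arbitrary D) E) (U \<union> D) C"

lemma premise_derivable_imp_premise_deduction: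
  assumes "premise_derivable r E U C Q" and "\<not> normally_derivable E U C"
  shows "\<exists>d. premise_deduction r E U C Q d"
proof (cases Q)
  case (Major A)
  with assms(1) obtain i where "(i, A) \<in> E" "(i, A) \<in> U" by auto
  with Major have "premise_deduction r E U C Q (Assm i A)"
    by (auto simp: premise_deduction_def intro: deduction.intros majors_in.intros)
  then show ?thesis ..
next
  case (Minor A)
  with assms(1) obtain i where "(i, A) \<in> U" by auto
  with Minor have "premise_deduction r E U C Q (Assm i A)"
    by (auto simp: premise_deduction_def intro: deduction.intros majors_in.intros)
  then show ?thesis ..
next
  case (Arbitrary D)
  with assms(1) obtain d where d: "deduction d" "majors_in (eliminable_above r Q E) d"
    "concl d = C" "undischarged d \<subseteq> U \<union> D"
    by (auto simp: normally_derivable_def)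
  have "D \<inter> undischarged d \<noteq> {}"
  proof
    assume vacuous: "D \<inter> undischarged d = {}"
    then have "majors_in E d"
      by (intro majors_in_undischarged_mono[OF d(1,2)]) (auto simp: eliminable_above_def Arbitrary)
    with vacuous d assms(2) show False unfolding normally_derivable_def by blast
  qed
  with d Arbitrary have "premise_deduction r E U C Q d"
    by (auto simp: premise_deduction_def)
  then show ?thesis ..
qed

lemma normally_derivable_Infer:
  assumes "\<And>Q. Q \<in> set (rule_premises r) \<Longrightarrow> premise_derivable r E U C Q"
  shows "normally_derivable E U C"
proof (rule ccontr)
  assume underivable: "\<not> normally_derivable E U C"
  have "\<forall>Q \<in> set (rule_premises r). \<exists>d. premise_deduction r E U C Q d"
    using premise_derivable_imp_premise_deduction[OF assms underivable] by blast
  then obtain f where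
    "\<And>Q. Q \<in> set (rule_premises r) \<Longrightarrow> premise_deduction r E U C Q (f Q)"
    by metis
  then have "normally_derivable E U C"
    by (rule premise_deductions_imp_normally_derivable)
  with underivable show False ..
qed

section \<open>Saturated sets of assumptions\<close>

lemma maximal_superset_of_finite_character:
  fixes R :: "'b set \<Rightarrow> bool"
  assumes "\<not> R X" and mono: "\<And>Y Z. R Y \<Longrightarrow> Y \<subseteq> Z \<Longrightarrow> R Z"
    and finite: "\<And>Y. R Y \<Longrightarrow> \<exists>Z \<subseteq> Y. finite Z \<and> R Z"
  obtains M where "X \<subseteq> M" "\<not> R M" "\<And>x. x \<notin> M \<Longrightarrow> R (insert x M)"
proof -
  let ?\<A> = "{Y. X \<subseteq> Y \<and> \<not> R Y}"
  have Union_chain: "\<Union>\<C> \<in> ?\<A>" if nonempty: "\<C> \<noteq> {}" and chain: "subset.chain ?\<A> \<C>" for \<C>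
  proof -
    have \<C>: "\<C> \<subseteq> ?\<A>" using chain by (simp add: subset.chain_def)
    have "\<not> R (\<Union>\<C>)"
    proof
      assume "R (\<Union>\<C>)"
      from finite[OF this] obtain Z where "finite Z" "Z \<subseteq> \<Union>\<C>" and Z: "R Z" by blast
      from this(1,2) nonempty chain obtain B where "B \<in> \<C>" "Z \<subseteq> B"
        by (rule finite_subset_Union_chain)
      from Z \<open>Z \<subseteq> B\<close> have "R B" by (rule mono)
      with \<open>B \<in> \<C>\<close> \<C> show False by blast
    qed
    with nonempty \<C> show ?thesis by blast
  qed
  have "?\<A> \<noteq> {}" using \<open>\<not> R X\<close> by blast
  from subset_Zorn_nonempty[OF this Union_chain]
  obtain M where "X \<subseteq> M" "\<not> R M" and maximal: "\<forall>Y \<in> ?\<A>. M \<subseteq> Y \<longrightarrow> Y = M"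
    by blast
  have "R (insert x M)" if "x \<notin> M" for x
    using maximal \<open>X \<subseteq> M\<close> that by blast
  with \<open>X \<subseteq> M\<close> \<open>\<not> R M\<close> show thesis by (rule that)
qed

locale saturated =
  fixes E U :: "'a assm_class set" and C :: "'a form"
  assumes underivable: "\<not> normally_derivable E U C"
    and eliminable_subset: "E \<subseteq> U"
    and eliminable_maximal: "x \<notin> E \<Longrightarrow> normally_derivable (insert x E) (insert x U) C"
    and maximal: "x \<notin> U \<Longrightarrow> normally_derivable E (insert x U) C"

lemma saturated_extension:
  assumes "\<not> normally_derivable X X C"
  obtains E U where "X \<subseteq> E" "saturated E U C"
proof (rule maximal_superset_of_finite_character[of "\<lambda>Y. normally_derivable Y Y C", OF assms])
  show "normally_derivable Z Z C" if "normally_derivable Y Y C" "Y \<subseteq> Z" for Y Z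
    using that normally_derivable_mono by blast
  show "\<exists>Z \<subseteq> Y. finite Z \<and> normally_derivable Z Z C" if "normally_derivable Y Y C" for Y
    using that by (metis inf.absorb_iff2 normally_derivable_finite)
  fix E
  assume "X \<subseteq> E" and E: "\<not> normally_derivable E E C"
    and E_maximal: "\<And>x. x \<notin> E \<Longrightarrow> normally_derivable (insert x E) (insert x E) C"
  show thesis
  proof (rule maximal_superset_of_finite_character[of "\<lambda>Y. normally_derivable E Y C", OF E])
    show "normally_derivable E Z C" if "normally_derivable E Y C" "Y \<subseteq> Z" for Y Z
      using that normally_derivable_mono by blast
    show "\<exists>Z \<subseteq> Y. finite Z \<and> normally_derivable E Z C" if "normally_derivable E Y C" for Y
      using that by (meson inf_le1 normally_derivable_finite normally_derivable_mono order_refl)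
    fix U
    assume U: "E \<subseteq> U" "\<not> normally_derivable E U C"
      "\<And>x. x \<notin> U \<Longrightarrow> normally_derivable E (insert x U) C"
    have "normally_derivable (insert x E) (insert x U) C" if "x \<notin> E" for x
      using E_maximal[OF that] \<open>E \<subseteq> U\<close> by (blast intro: normally_derivable_mono)
    with U have "saturated E U C" by unfold_locales
    with \<open>X \<subseteq> E\<close> show thesis by (rule that)
  qed
qed

lemma Imp_neq_antecedent: "Imp A B \<noteq> A"
  by (induction A arbitrary: B) auto

lemma Neg_neq: "Neg A \<noteq> A"
  by (induction A) auto

context saturated
begin

definition asserted :: "'a form \<Rightarrow> bool" where
  "asserted A \<longleftrightarrow> A \<in> snd ` E"

definition admitted :: "'a form \<Rightarrow> bool" where
  "admitted A \<longleftrightarrow> A \<in> snd ` U"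

lemma underivable_premise: "\<exists>Q \<in> set (rule_premises r). \<not> premise_derivable r E U C Q"
  using normally_derivable_Infer underivable by blast

lemma underivable_Major: "\<not> premise_derivable r E U C (Major A) \<Longrightarrow> \<not> asserted A"
  using eliminable_subset by (simp add: asserted_def inf.absorb1)

lemma underivable_Minor: "\<not> premise_derivable r E U C (Minor A) \<Longrightarrow> \<not> admitted A"
  by (simp add: admitted_def)

lemma underivable_Arbitrary_subset:
  assumes "\<not> premise_derivable r E U C (Arbitrary D)"
    and "\<forall>x \<in> D. major_assumption r \<noteq> Some (snd x)"
  shows "D \<subseteq> E"
proof
  fix x
  assume "x \<in> D"
  show "x \<in> E"
  proof (rule ccontr)
    assume "x \<notin> E"
    then have "normally_derivable (insert x E) (insert x U) C"
      by (rule eliminable_maximal)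
    then have "normally_derivable (eliminable_above r (Arbitrary D) E) (U \<union> D) C"
      by (rule normally_derivable_mono)
        (use \<open>x \<in> D\<close> assms(2) in \<open>auto simp: eliminable_above_def\<close>)
    with assms(1) show False by simp
  qed
qed

lemma underivable_Arbitrary_asserted:
  assumes "\<not> premise_derivable r E U C (Arbitrary {(i, A)})" and "major_assumption r \<noteq> Some A"
  shows "asserted A"
  using underivable_Arbitrary_subset[OF assms(1)] assms(2) by (force simp: asserted_def)

lemma underivable_Arbitrary_admitted:
  assumes "\<not> premise_derivable r E U C (Arbitrary {(i, A)})"
  shows "admitted A"
proof -
  have "(i, A) \<in> U"
  proof (rule ccontr)
    assume "(i, A) \<notin> U"
    then have "normally_derivable E (insert (i, A) U) C"
      by (rule maximal)
    then have "normally_derivable (eliminable_above r (Arbitrary {(i, A)}) E) (U \<union> {(i, A)}) C"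
      by (rule normally_derivable_mono)
        (use \<open>(i, A) \<notin> U\<close> eliminable_subset in \<open>auto simp: eliminable_above_def\<close>)
    with assms show False by simp
  qed
  then show ?thesis by (force simp: admitted_def)
qed

lemmas underivable_premise_dests =
  underivable_Major underivable_Minor underivable_Arbitrary_asserted underivable_Arbitrary_admitted

declare premise_derivable.simps [simp del]

text \<open>Every class of a formula that is not admitted lies outside \<open>U\<close>, so the number \<open>0\<close> is always
  fresh where freshness matters.\<close>

lemma admitted_And: "admitted A \<Longrightarrow> admitted B \<Longrightarrow> admitted (And A B)"
  using underivable_premise[of "AndI A B 0"] by (auto dest: underivable_premise_dests)

lemma asserted_And:
  assumes "asserted (And A B)"
  shows "asserted A \<and> asserted B"
proof -
  have "\<not> premise_derivable (AndE A B 0 0) E U C (Arbitrary {(0, A), (0, B)})"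
    using underivable_premise[of "AndE A B 0 0"] assms by (auto dest: underivable_Major)
  then have "{(0, A), (0, B)} \<subseteq> E"
    by (rule underivable_Arbitrary_subset) simp
  then show ?thesis by (force simp: asserted_def)
qed

lemma admitted_Or: "admitted A \<or> admitted B \<Longrightarrow> admitted (Or A B)"
  using underivable_premise[of "OrI1 A B 0"] underivable_premise[of "OrI2 A B 0"]
  by (auto dest: underivable_premise_dests)

lemma asserted_Or: "asserted (Or A B) \<Longrightarrow> asserted A \<or> asserted B"
  using underivable_premise[of "OrE A B 0 0"] by (auto dest: underivable_premise_dests)

lemma admitted_Imp: "\<not> asserted A \<or> admitted B \<Longrightarrow> admitted (Imp A B)"
  using underivable_premise[of "TR A B 0 0"] underivable_premise[of "ImpI A B 0"]
  by (auto dest: underivable_premise_dests simp: Imp_neq_antecedent)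

lemma asserted_Imp: "asserted (Imp A B) \<Longrightarrow> \<not> admitted A \<or> asserted B"
  using underivable_premise[of "ImpE A B 0"] by (auto dest: underivable_premise_dests)

lemma admitted_Neg: "\<not> asserted A \<Longrightarrow> admitted (Neg A)"
  using underivable_premise[of "NegI A 0 0"]
  by (auto dest: underivable_premise_dests simp: Neg_neq)

lemma asserted_Neg: "asserted (Neg A) \<Longrightarrow> \<not> admitted A"
  using underivable_premise[of "NegE A"] by (auto dest: underivable_premise_dests)

lemma asserted_imp_admitted: "asserted A \<Longrightarrow> admitted A"
  using eliminable_subset by (auto simp: asserted_def admitted_def)

definition canonical_valuation :: "'a \<Rightarrow> bool" where
  "canonical_valuation a \<longleftrightarrow> asserted (Atom a)"

lemma asserted_imp_holds_imp_admitted: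
  "(asserted A \<longrightarrow> holds canonical_valuation A) \<and> (holds canonical_valuation A \<longrightarrow> admitted A)"
proof (induction A)
  case (Atom a)
  then show ?case by (simp add: canonical_valuation_def asserted_imp_admitted)
next
  case (Neg A)
  then show ?case using admitted_Neg[of A] asserted_Neg[of A] by auto
next
  case (Imp A B)
  then show ?case using admitted_Imp[of A B] asserted_Imp[of A B] by auto
next
  case (And A B)
  then show ?case using admitted_And[of A B] asserted_And[of A B] by auto
next
  case (Or A B)
  then show ?case using admitted_Or[of A B] asserted_Or[of A B] by auto
qed

lemma holds_canonical_valuation: "x \<in> E \<Longrightarrow> holds canonical_valuation (snd x)"
  using asserted_imp_holds_imp_admitted by (simp add: asserted_def)

lemma not_holds_canonical_valuation: "\<not> holds canonical_valuation C"
proof -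
  have "\<not> admitted C"
    using underivable by (auto simp: admitted_def dest: normally_derivable_Assm)
  then show ?thesis using asserted_imp_holds_imp_admitted by blast
qed

end

lemma normally_derivable_complete:
  assumes "\<And>v. \<forall>x \<in> X. holds v (snd x) \<Longrightarrow> holds v C"
  shows "normally_derivable X X C"
proof (rule ccontr)
  assume "\<not> normally_derivable X X C"
  then obtain E U where "X \<subseteq> E" and "saturated E U C"
    by (rule saturated_extension)
  interpret saturated E U C by fact
  have "\<forall>x \<in> X. holds canonical_valuation (snd x)"
    using \<open>X \<subseteq> E\<close> holds_canonical_valuation by blast
  with assms not_holds_canonical_valuation show False by blast
qed

theorem theorem2:
  fixes d :: "'a tree"
  assumes "deduction d"
  shows "\<exists>d'. deduction d' \<and> normal d' \<and> concl d' = concl d \<and>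
           undischarged d' \<subseteq> undischarged d"
proof -
  have "normally_derivable (undischarged d) (undischarged d) (concl d)"
    using deduction_sound[OF assms] by (rule normally_derivable_complete)
  then show ?thesis
    unfolding normally_derivable_def using majors_in_imp_normal by blast
qed

end
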